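(* Let $d$ be a constant dimension. The intersection graph of every set of $n$ axis-aligned boxes in $\mathbb{R}^d$ has a 3-hop spanner with $O(n\log^{d-1} n)$ edges.
   Context: The intersection graph of a family of sets has one vertex per set and an (unweighted) edge between two distinct sets iff they have nonempty intersection. For a simple graph $G=(V,E)$, a $t$-hop spanner is a spanning subgraph $G'=(V,E')$, $E'\subseteq E$, with $d_{G'}(x,y)\le t\cdot d_G(x,y)$ for all $x,y\in V$, where $d_G$ is the shortest-path (hop) distance. An axis-aligned box is a product of $d$ intervals. The constant in the $O(\cdot)$ bound may depend on $d$. *)

theory Defs
  imports "HOL-Analysis.Analysis" "HOL-Library.Extended_Nat" "HOL-Library.Landau_Symbols"
begin

text \<open>A graph is a pair of a vertex set and a set of edges, an edge being the set of its endpoints.\<close>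

type_synonym 'v graph = "'v set \<times> 'v set set"

abbreviation verts :: "'v graph \<Rightarrow> 'v set" where "verts G \<equiv> fst G"

abbreviation edges :: "'v graph \<Rightarrow> 'v set set" where "edges G \<equiv> snd G"

definition simple_graph :: "'v graph \<Rightarrow> bool" where
  "simple_graph G \<longleftrightarrow> (\<forall>e \<in> edges G. e \<subseteq> verts G \<and> card e = 2)"

definition graph_path :: "'v graph \<Rightarrow> 'v \<Rightarrow> 'v list \<Rightarrow> 'v \<Rightarrow> bool" where
  "graph_path G x p y \<longleftrightarrow>
     p \<noteq> [] \<and> hd p = x \<and> last p = y \<and> distinct p \<and> set p \<subseteq> verts G \<and>
     (\<forall>i. Suc i < length p \<longrightarrow> {p ! i, p ! Suc i} \<in> edges G)"

text \<open>The distance between vertices in different components is \<open>\<infinity>\<close>, the infimum of the empty set.\<close>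

definition hop_dist :: "'v graph \<Rightarrow> 'v \<Rightarrow> 'v \<Rightarrow> enat" where
  "hop_dist G x y = (INF p \<in> {p. graph_path G x p y}. enat (length p - 1))"

definition hop_spanner :: "nat \<Rightarrow> 'v graph \<Rightarrow> 'v graph \<Rightarrow> bool" where
  "hop_spanner t G G' \<longleftrightarrow>
     simple_graph G \<and> verts G' = verts G \<and> edges G' \<subseteq> edges G \<and>
     (\<forall>x \<in> verts G. \<forall>y \<in> verts G. hop_dist G' x y \<le> enat t * hop_dist G x y)"

definition intersection_graph :: "'a set set \<Rightarrow> 'a set graph" where
  "intersection_graph F = (F, {{A, B} | A B. A \<in> F \<and> B \<in> F \<and> A \<noteq> B \<and> A \<inter> B \<noteq> {}})"

lemma simple_graph_intersection_graph: "simple_graph (intersection_graph F)"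
  by (fastforce simp: simple_graph_def intersection_graph_def card_2_iff)

text \<open>The intervals are arbitrary: open, closed or half-open, bounded or not, possibly degenerate.\<close>

definition axis_aligned_box :: "(real ^ 'd) set \<Rightarrow> bool" where
  "axis_aligned_box b \<longleftrightarrow>
     (\<exists>I :: 'd \<Rightarrow> real set. (\<forall>i. is_interval (I i)) \<and> b = {x. \<forall>i. x $ i \<in> I i})"

end

theory Submission
  imports Defs
begin

text \<open>Two boxes meet iff in every coordinate one of the two intervals contains the left endpoint of
  the other. Fixing for each coordinate which one does gives \<open>2\<^sup>d\<close> bipartite point-in-interval
  relations. Distributing the intervals over canonical dyadic blocks, as in a segment tree, removes
  one coordinate at the price of a factor \<open>O(log n)\<close>. The last coordinate costs only a constant
  factor instead: a greedy chain of intervals covers the points in such a way that every interval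
  meets at most two consecutive groups of points, and within a group the path through the covering
  interval has three hops. This saves one logarithm.\<close>

section \<open>Bipartite 3-hop spanners and how they combine\<close>

text \<open>Edges are ordered pairs, so the two sides may share a type without being confused. The
  detour \<open>a\<close>, \<open>b'\<close>, \<open>a'\<close>, \<open>b\<close> may degenerate:
  \<open>b' = b\<close> and \<open>a' = a\<close> cover an edge that is kept.\<close>

definition bi_spanner :: "('a \<times> 'b) set \<Rightarrow> ('a \<times> 'b) set \<Rightarrow> bool" where
  "bi_spanner E S \<longleftrightarrow> S \<subseteq> E \<and>
     (\<forall>a b. (a, b) \<in> E \<longrightarrow> (\<exists>a' b'. (a, b') \<in> S \<and> (a', b') \<in> S \<and> (a', b) \<in> S))"

text \<open>Quantifying over all finite \<open>A\<close> and \<open>B\<close> makes the bound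
  hereditary, so it can be applied to subproblems whose sizes are then summed. As \<open>S\<close>
  lies inside \<open>A \<times> B\<close>, it is finite and \<open>card S\<close> is a genuine
  count.\<close>

definition sparsely_spanned :: "nat \<Rightarrow> ('a \<times> 'b) set \<Rightarrow> bool" where
  "sparsely_spanned K E \<longleftrightarrow> (\<forall>A B. finite A \<longrightarrow> finite B \<longrightarrow>
     (\<exists>S. bi_spanner (E \<inter> A \<times> B) S \<and> card S \<le> K * (card A + card B)))"

lemma bi_spanner_empty: "bi_spanner {} {}"
  by (auto simp: bi_spanner_def)

lemma bi_spanner_UN:
  assumes "\<And>i. i \<in> I \<Longrightarrow> bi_spanner (E i) (S i)"
  shows "bi_spanner (\<Union>i\<in>I. E i) (\<Union>i\<in>I. S i)"
  unfolding bi_spanner_def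
proof (intro conjI allI impI)
  show "(\<Union>i\<in>I. S i) \<subseteq> (\<Union>i\<in>I. E i)"
    using assms unfolding bi_spanner_def by blast
  fix a b assume "(a, b) \<in> (\<Union>i\<in>I. E i)"
  then obtain i where i: "i \<in> I" "(a, b) \<in> E i" by blast
  with assms obtain a' b' where "(a, b') \<in> S i" "(a', b') \<in> S i" "(a', b) \<in> S i"
    unfolding bi_spanner_def by blast
  with i show "\<exists>a' b'. (a, b') \<in> (\<Union>i\<in>I. S i) \<and> (a', b') \<in> (\<Union>i\<in>I. S i) \<and> (a', b) \<in> (\<Union>i\<in>I. S i)"
    by blast
qed

lemma bi_spanner_Un:
  assumes "bi_spanner E S" "bi_spanner E' S'"
  shows "bi_spanner (E \<union> E') (S \<union> S')"
  using bi_spanner_UN[of "UNIV :: bool set" "\<lambda>i. if i then E else E'" "\<lambda>i. if i then S else S'"] assms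
  by (simp add: UNIV_bool Un_commute)

lemma bi_spanner_converse: "bi_spanner E S \<Longrightarrow> bi_spanner (E\<inverse>) (S\<inverse>)"
  unfolding bi_spanner_def by blast

lemma sparsely_spanned_converse:
  fixes E :: "('a \<times> 'b) set"
  assumes "sparsely_spanned K E"
  shows "sparsely_spanned K (E\<inverse>)"
  unfolding sparsely_spanned_def
proof (intro allI impI)
  fix A :: "'b set" and B :: "'a set" assume "finite A" "finite B"
  with assms obtain S where S: "bi_spanner (E \<inter> B \<times> A) S" "card S \<le> K * (card B + card A)"
    unfolding sparsely_spanned_def by blast
  have "(E \<inter> B \<times> A)\<inverse> = E\<inverse> \<inter> A \<times> B" by blast
  with bi_spanner_converse[OF S(1)] S(2)
  show "\<exists>S. bi_spanner (E\<inverse> \<inter> A \<times> B) S \<and> card S \<le> K * (card A + card B)"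
    by (intro exI[of _ "S\<inverse>"]) (simp add: add.commute)
qed

lemma sparsely_spanned_UN:
  fixes E :: "'i \<Rightarrow> ('a \<times> 'b) set"
  assumes "finite I" "\<And>i. i \<in> I \<Longrightarrow> sparsely_spanned K (E i)"
  shows "sparsely_spanned (card I * K) (\<Union>i\<in>I. E i)"
  unfolding sparsely_spanned_def
proof (intro allI impI)
  fix A :: "'a set" and B :: "'b set" assume AB: "finite A" "finite B"
  have "\<forall>i\<in>I. \<exists>S. bi_spanner (E i \<inter> A \<times> B) S \<and> card S \<le> K * (card A + card B)"
    using assms(2) AB unfolding sparsely_spanned_def by blast
  then obtain S where S: "\<And>i. i \<in> I \<Longrightarrow> bi_spanner (E i \<inter> A \<times> B) (S i)"
      "\<And>i. i \<in> I \<Longrightarrow> card (S i) \<le> K * (card A + card B)"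
    by metis
  have "card (\<Union>i\<in>I. S i) \<le> (\<Sum>i\<in>I. card (S i))"
    using assms(1) by (rule card_UN_le)
  also have "\<dots> \<le> of_nat (card I) * (K * (card A + card B))"
    by (rule sum_bounded_above) (use S(2) in auto)
  finally have "card (\<Union>i\<in>I. S i) \<le> card I * K * (card A + card B)"
    by (simp add: mult.assoc)
  moreover have "bi_spanner ((\<Union>i\<in>I. E i) \<inter> A \<times> B) (\<Union>i\<in>I. S i)"
    using bi_spanner_UN[OF S(1), of I id] by (simp add: Int_UN_distrib2 Int_commute)
  ultimately show "\<exists>S. bi_spanner ((\<Union>i\<in>I. E i) \<inter> A \<times> B) S \<and> card S \<le> card I * K * (card A + card B)"
    by blast
qed

text \<open>Each \<open>a\<close> admits at most one key and each \<open>b\<close> has exactly one,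
  so the subproblems for different keys share no vertices. Their sizes add up to at most the
  original size, and the factor \<open>K\<close> is kept however many keys there are.\<close>

lemma sparsely_spanned_fibres:
  fixes E :: "('a \<times> 'b) set" and R :: "'a \<Rightarrow> 'k \<Rightarrow> bool" and g :: "'b \<Rightarrow> 'k"
  assumes "sparsely_spanned K E" and "\<And>a k k'. R a k \<Longrightarrow> R a k' \<Longrightarrow> k = k'"
  shows "sparsely_spanned K {(a, b). (a, b) \<in> E \<and> R a (g b)}"
  unfolding sparsely_spanned_def
proof (intro allI impI)
  fix A :: "'a set" and B :: "'b set" assume AB: "finite A" "finite B"
  define A' where "A' k = {a \<in> A. R a k}" for k
  define B' where "B' k = {b \<in> B. g b = k}" for k
  have fin: "finite (A' k)" "finite (B' k)" for k
    using AB by (auto simp: A'_def B'_def)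
  have "\<forall>k. \<exists>S. bi_spanner (E \<inter> A' k \<times> B' k) S \<and> card S \<le> K * (card (A' k) + card (B' k))"
    using assms(1) fin unfolding sparsely_spanned_def by blast
  then obtain S where S: "\<And>k. bi_spanner (E \<inter> A' k \<times> B' k) (S k)"
      "\<And>k. card (S k) \<le> K * (card (A' k) + card (B' k))"
    by metis
  \<comment> \<open>A key that no \<open>b\<close> in \<open>B\<close> carries contributes no edges,
    so a finite union suffices.\<close>
  let ?M = "g ` B"
  have "(\<Sum>k\<in>?M. card (A' k)) = card (\<Union>k\<in>?M. A' k)"
    by (rule card_UN_disjoint[symmetric]) (use AB fin assms(2) in \<open>auto simp: A'_def\<close>)
  also have "\<dots> \<le> card A"
    by (rule card_mono) (use AB in \<open>auto simp: A'_def\<close>)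
  finally have sA: "(\<Sum>k\<in>?M. card (A' k)) \<le> card A" .
  have "(\<Sum>k\<in>?M. card (B' k)) = card (\<Union>k\<in>?M. B' k)"
    by (rule card_UN_disjoint[symmetric]) (use AB fin in \<open>auto simp: B'_def\<close>)
  also have "\<dots> \<le> card B"
    by (rule card_mono) (use AB in \<open>auto simp: B'_def\<close>)
  finally have sB: "(\<Sum>k\<in>?M. card (B' k)) \<le> card B" .
  have "card (\<Union>k\<in>?M. S k) \<le> (\<Sum>k\<in>?M. card (S k))"
    using AB by (intro card_UN_le) auto
  also have "\<dots> \<le> (\<Sum>k\<in>?M. K * (card (A' k) + card (B' k)))"
    by (intro sum_mono S(2))
  also have "\<dots> = K * ((\<Sum>k\<in>?M. card (A' k)) + (\<Sum>k\<in>?M. card (B' k)))"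
    by (simp only: sum.distrib[symmetric] sum_distrib_left[symmetric])
  also have "\<dots> \<le> K * (card A + card B)"
    using sA sB by (intro mult_left_mono add_mono) auto
  finally have "card (\<Union>k\<in>?M. S k) \<le> K * (card A + card B)" .
  moreover have "(\<Union>k\<in>?M. E \<inter> A' k \<times> B' k) = {(a, b). (a, b) \<in> E \<and> R a (g b)} \<inter> A \<times> B"
    by (auto simp: A'_def B'_def)
  then have "bi_spanner ({(a, b). (a, b) \<in> E \<and> R a (g b)} \<inter> A \<times> B) (\<Union>k\<in>?M. S k)"
    using bi_spanner_UN[of ?M "\<lambda>k. E \<inter> A' k \<times> B' k" S] S(1) by simp
  ultimately show "\<exists>S. bi_spanner ({(a, b). (a, b) \<in> E \<and> R a (g b)} \<inter> A \<times> B) S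
      \<and> card S \<le> K * (card A + card B)"
    by blast
qed

section \<open>Canonical dyadic blocks of an integer interval\<close>

text \<open>Block \<open>m\<close> of level \<open>j\<close> consists of the numbers
  \<open>x\<close> with \<open>x div 2 ^ j = m\<close>; it is required to lie inside the closed
  interval from \<open>l\<close> to \<open>h\<close>, hence the \<open>Suc h\<close>.\<close>

definition dyadic_within :: "nat \<Rightarrow> nat \<Rightarrow> nat \<Rightarrow> nat \<Rightarrow> bool" where
  "dyadic_within l h j m \<longleftrightarrow> l \<le> m * 2 ^ j \<and> (m + 1) * 2 ^ j \<le> Suc h"

text \<open>These are the maximal dyadic blocks inside the interval, the canonical nodes of a
  segment tree: \<open>m div 2\<close> is the parent of \<open>m\<close>.\<close>

definition canonical_block :: "nat \<Rightarrow> nat \<Rightarrow> nat \<Rightarrow> nat \<Rightarrow> bool" where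
  "canonical_block l h j m \<longleftrightarrow> dyadic_within l h j m \<and> \<not> dyadic_within l h (Suc j) (m div 2)"

text \<open>Of two distinct even blocks inside the interval, the right sibling of the first still
  ends before the second does, so the parent of the first would fit as well, against maximality. Odd
  blocks are symmetric: the left sibling of the later one starts no earlier than the first.\<close>

lemma canonical_block_unique:
  assumes "canonical_block l h j m" "canonical_block l h j m'" "even m = even m'"
  shows "m = m'"
proof -
  define q :: nat where "q = 2 ^ j"
  have q: "q > 0" by (simp add: q_def)
  show ?thesis
  proof (cases "even m")
    case True
    have "x = y" if c: "canonical_block l h j x" "canonical_block l h j y" and e: "even x" "even y"
        and le: "x \<le> y" for x y
    proof (rule ccontr)
      assume "x \<noteq> y"
      with le e have "x + 2 \<le> y" by (auto elim!: evenE)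
      then have "(x + 2) * q \<le> (y + 1) * q" by (intro mult_right_mono) auto
      also have "\<dots> \<le> Suc h" using c(2) by (simp add: canonical_block_def dyadic_within_def q_def)
      finally have "dyadic_within l h (Suc j) (x div 2)"
        using c(1) e(1) by (auto simp: canonical_block_def dyadic_within_def q_def algebra_simps elim!: evenE)
      with c(1) show False by (simp add: canonical_block_def)
    qed
    then show ?thesis using assms True by (metis nat_le_linear)
  next
    case False
    have "x = y" if c: "canonical_block l h j x" "canonical_block l h j y" and e: "odd x" "odd y"
        and le: "x \<le> y" for x y
    proof (rule ccontr)
      assume "x \<noteq> y"
      with le e have "x \<le> y - 1" by auto
      have "l \<le> x * q" using c(1) by (simp add: canonical_block_def dyadic_within_def q_def)
      also have "\<dots> \<le> (y - 1) * q" using \<open>x \<le> y - 1\<close> by (intro mult_right_mono) auto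
      finally have "dyadic_within l h (Suc j) (y div 2)"
        using c(2) e(2) by (auto simp: canonical_block_def dyadic_within_def q_def algebra_simps elim!: oddE)
      with c(2) show False by (simp add: canonical_block_def)
    qed
    then show ?thesis using assms False by (metis nat_le_linear)
  qed
qed

text \<open>Take the highest level at which the block around \<open>x\<close> still fits. Level 0
  always fits, being the single point \<open>x\<close>, and a block of level above \<open>L\<close>
  is too long.\<close>

lemma canonical_block_exists:
  assumes "h < 2 ^ L" "l \<le> x" "x \<le> h"
  shows "\<exists>j \<le> L. canonical_block l h j (x div 2 ^ j)"
proof -
  let ?P = "\<lambda>j. dyadic_within l h j (x div 2 ^ j)"
  have P0: "?P 0" using assms by (simp add: dyadic_within_def)
  have bound: "j \<le> L" if "?P j" for j
  proof -
    have "(2::nat) ^ j \<le> (x div 2 ^ j + 1) * 2 ^ j" by simp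
    also have "\<dots> \<le> 2 ^ L" using that assms(1) by (simp add: dyadic_within_def)
    finally show ?thesis by simp
  qed
  define j where "j = (GREATEST j. ?P j)"
  have "?P j" unfolding j_def by (rule GreatestI_nat[where P = ?P, OF P0 bound])
  moreover have "\<not> ?P (Suc j)"
  proof
    assume "?P (Suc j)"
    then have "Suc j \<le> j" unfolding j_def by (rule Greatest_le_nat[where P = ?P, OF _ bound])
    then show False by simp
  qed
  moreover have "x div 2 ^ Suc j = x div 2 ^ j div 2"
    by (simp add: div_mult2_eq[symmetric] mult.commute)
  ultimately show ?thesis using bound by (auto simp: canonical_block_def)
qed

lemma canonical_block_contained:
  assumes "canonical_block l h j (x div 2 ^ j)"
  shows "l \<le> x" "x \<le> h"
proof -
  have a: "l \<le> x div 2 ^ j * 2 ^ j" "(x div 2 ^ j + 1) * 2 ^ j \<le> Suc h"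
    using assms by (auto simp: canonical_block_def dyadic_within_def)
  show "l \<le> x" using a(1) div_times_less_eq_dividend le_trans by blast
  have "x < (x div 2 ^ j + 1) * 2 ^ j"
    using dividend_less_div_times[of "2 ^ j" x] by simp
  then show "x \<le> h" using a(2) by simp
qed

text \<open>At each level, every interval has at most one even and one odd canonical block, so the
  subproblems of one level and parity are disjoint.\<close>

lemma sparsely_spanned_interval_constraint:
  fixes lo hi :: "'a \<Rightarrow> nat" and x :: "'b \<Rightarrow> nat"
  assumes "sparsely_spanned K E" and "\<And>a. hi a < 2 ^ L"
  shows "sparsely_spanned (2 * Suc L * K) {(a, b). (a, b) \<in> E \<and> lo a \<le> x b \<and> x b \<le> hi a}"
proof -
  define F where "F = (\<lambda>(j, p). {(a, b). (a, b) \<in> E \<and>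
      (canonical_block (lo a) (hi a) j (x b div 2 ^ j) \<and> even (x b div 2 ^ j) = p)})"
  have "sparsely_spanned K (F (j, p))" for j p
    unfolding F_def prod.case
    by (rule sparsely_spanned_fibres[OF assms(1),
          of "\<lambda>a k. canonical_block (lo a) (hi a) j k \<and> even k = p" "\<lambda>b. x b div 2 ^ j"])
       (use canonical_block_unique in blast)
  then have "sparsely_spanned (card ({..L} \<times> (UNIV :: bool set)) * K) (\<Union>i\<in>{..L} \<times> UNIV. F i)"
    by (intro sparsely_spanned_UN) auto
  moreover have "(\<Union>i\<in>{..L} \<times> UNIV. F i) = {(a, b). (a, b) \<in> E \<and> lo a \<le> x b \<and> x b \<le> hi a}"
    using canonical_block_exists[OF assms(2)] canonical_block_contained
    by (fastforce simp: F_def)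
  ultimately show ?thesis by (simp add: card_cartesian_product mult.commute)
qed

section \<open>A single coordinate: points and intervals on a line\<close>

text \<open>Greedy cover: \<open>C\<close> is the interval reaching farthest among those containing the leftmost
  point. An interval meeting the points covered by \<open>C\<close> and also later ones starts strictly after the
  leftmost point and before all later ones; the last summand of the bound pays for the second edge
  of such an interval.\<close>

lemma point_interval_bi_spanner:
  fixes lo hi :: "'a \<Rightarrow> nat" and x :: "'b \<Rightarrow> nat"
  assumes "finite B" "finite A"
  shows "\<exists>S. bi_spanner ({(a, b). lo a \<le> x b \<and> x b \<le> hi a} \<inter> A \<times> B) S \<and>
      card S \<le> card B + card A + card {a \<in> A. \<exists>b\<in>B. x b < lo a}"
  using assms
proof (induction "card B" arbitrary: A B rule: less_induct)
  case less
  let ?E = "{(a, b). lo a \<le> x b \<and> x b \<le> hi a}"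
  let ?W = "\<lambda>A B. {a \<in> A. \<exists>b\<in>B. x b < lo a}"
  show ?case
  proof (cases "B = {}")
    case True
    then show ?thesis using bi_spanner_empty by (intro exI[of _ "{}"]) auto
  next
    case False
    then obtain p where p: "p \<in> B" "\<And>b. b \<in> B \<Longrightarrow> x p \<le> x b"
      using less.prems(1) by (meson arg_min_if_finite(1) arg_min_least)
    show ?thesis
    proof (cases "\<exists>a\<in>A. lo a \<le> x p \<and> x p \<le> hi a")
      \<comment> \<open>The leftmost point lies in no interval, so deleting it loses no
        edge.\<close>
      case False
      have "card (B - {p}) < card B" using less.prems(1) p(1) by (rule card_Diff1_less)
      then obtain S where S: "bi_spanner (?E \<inter> A \<times> (B - {p})) S"
          "card S \<le> card (B - {p}) + card A + card (?W A (B - {p}))"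
        using less.hyps[of "B - {p}" A] less.prems by auto
      have "?E \<inter> A \<times> (B - {p}) = ?E \<inter> A \<times> B" using False by auto
      moreover have "card (?W A (B - {p})) \<le> card (?W A B)"
        using less.prems by (intro card_mono) auto
      moreover have "card (B - {p}) \<le> card B" using less.prems by (intro card_mono) auto
      ultimately show ?thesis using S by (intro exI[of _ S]) auto
    next
      case True
      let ?T = "{a \<in> A. lo a \<le> x p \<and> x p \<le> hi a}"
      have fT: "finite ?T" "?T \<noteq> {}" using True less.prems by auto
      have "Max (hi ` ?T) \<in> hi ` ?T" using fT by (intro Max_in) auto
      then obtain C where C: "C \<in> ?T" "Max (hi ` ?T) = hi C" by (rule imageE)
      then have Cmax: "hi a \<le> hi C" if "a \<in> ?T" for a
        unfolding C(2)[symmetric] using that fT by (intro Max_ge finite_imageI imageI)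
      define B0 where "B0 = {b \<in> B. x b \<le> hi C}"
      define B1 where "B1 = {b \<in> B. hi C < x b}"
      define A0 where "A0 = {a \<in> A. \<exists>b\<in>B0. lo a \<le> x b \<and> x b \<le> hi a}"
      define A1 where "A1 = {a \<in> A. \<exists>b\<in>B1. lo a \<le> x b \<and> x b \<le> hi a}"
      have fin: "finite B0" "finite B1" "finite A0" "finite A1"
        using less.prems by (auto simp: B0_def B1_def A0_def A1_def)
      have B: "card B = card B0 + card B1"
      proof -
        have "B = B0 \<union> B1" "B0 \<inter> B1 = {}" by (auto simp: B0_def B1_def)
        then show ?thesis using fin by (simp add: card_Un_disjoint)
      qed
      have "p \<in> B0" using p C by (simp add: B0_def)
      then have "card B0 > 0" using fin by (auto simp: card_gt_0_iff)
      then obtain S1 where S1: "bi_spanner (?E \<inter> A1 \<times> B1) S1"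
          "card S1 \<le> card B1 + card A1 + card (?W A1 B1)"
        using less.hyps[of B1 A1] B fin by auto
      have "\<forall>a\<in>A0. \<exists>b. b \<in> B0 \<and> lo a \<le> x b \<and> x b \<le> hi a" by (auto simp: A0_def)
      from bchoice[OF this] obtain q
        where "\<forall>a\<in>A0. q a \<in> B0 \<and> lo a \<le> x (q a) \<and> x (q a) \<le> hi a"
        by (elim exE)
      then have q: "q a \<in> B0 \<and> lo a \<le> x (q a) \<and> x (q a) \<le> hi a" if "a \<in> A0" for a
        using that by (rule bspec)
      \<comment> \<open>A star from \<open>C\<close> to all points of \<open>B0\<close>, plus one
        edge to a chosen point \<open>q a\<close> for every interval meeting \<open>B0\<close>. The
        detour from \<open>a\<close> to \<open>b\<close> is then \<open>a\<close>,
        \<open>q a\<close>, \<open>C\<close>, \<open>b\<close>.\<close>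
      define S0 where "S0 = Pair C ` B0 \<union> (\<lambda>a. (a, q a)) ` A0"
      have S0: "bi_spanner (?E \<inter> A0 \<times> B0) S0"
      proof -
        have CB0: "C \<in> A0 \<and> lo C \<le> x b \<and> x b \<le> hi C" if "b \<in> B0" for b
        proof -
          have "lo C \<le> x b" using C p(2)[of b] that by (auto simp: B0_def)
          with that C show ?thesis by (auto simp: A0_def B0_def)
        qed
        then have "S0 \<subseteq> ?E \<inter> A0 \<times> B0" using q by (auto simp: S0_def)
        moreover have "\<exists>a' b'. (a, b') \<in> S0 \<and> (a', b') \<in> S0 \<and> (a', b) \<in> S0"
          if "(a, b) \<in> ?E \<inter> A0 \<times> B0" for a b
          using that q[of a] by (intro exI[of _ C] exI[of _ "q a"]) (auto simp: S0_def)
        ultimately show ?thesis unfolding bi_spanner_def by blast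
      qed
      have "card S0 \<le> card (Pair C ` B0) + card ((\<lambda>a. (a, q a)) ` A0)"
        unfolding S0_def by (rule card_Un_le)
      also have "\<dots> \<le> card B0 + card A0" using fin by (intro add_mono card_image_le)
      finally have cS0: "card S0 \<le> card B0 + card A0" .
      \<comment> \<open>By the choice of \<open>C\<close>, an interval containing the leftmost point
        ends no later than \<open>C\<close> and misses \<open>B1\<close>. So every interval passed
        on to the recursion starts after \<open>p\<close>.\<close>
      have "A1 \<subseteq> ?W A B"
      proof
        fix a assume a: "a \<in> A1"
        then obtain b where b: "b \<in> B1" "lo a \<le> x b" "x b \<le> hi a" "a \<in> A" by (auto simp: A1_def)
        have "x p < lo a"
        proof (rule ccontr)
          assume "\<not> x p < lo a"
          moreover have "x p \<le> hi a" using p(2)[of b] b by (auto simp: B1_def)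
          ultimately have "hi a \<le> hi C" using b by (intro Cmax) auto
          then show False using b by (auto simp: B1_def)
        qed
        then show "a \<in> ?W A B" using b p by auto
      qed
      then have c1: "card A1 \<le> card (?W A B)" using less.prems by (intro card_mono) auto
      \<comment> \<open>An interval starting after some point of \<open>B1\<close> contains nothing
        of \<open>B0\<close>. Hence \<open>card A0\<close> and the last summand of the recursive
        bound are together charged to \<open>card A\<close>, while \<open>card A1\<close> is charged
        to \<open>card (?W A B)\<close>.\<close>
      have "A0 \<inter> ?W A1 B1 = {}" by (force simp: A0_def B0_def B1_def)
      then have "card A0 + card (?W A1 B1) = card (A0 \<union> ?W A1 B1)"
        using fin by (intro card_Un_disjoint[symmetric]) auto
      also have "\<dots> \<le> card A"
        using less.prems by (intro card_mono) (auto simp: A0_def A1_def)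
      finally have c0: "card A0 + card (?W A1 B1) \<le> card A" .
      have "card (S0 \<union> S1) \<le> card S0 + card S1" by (rule card_Un_le)
      with cS0 S1(2) c0 c1 B have "card (S0 \<union> S1) \<le> card B + card A + card (?W A B)" by linarith
      moreover have "?E \<inter> A0 \<times> B0 \<union> ?E \<inter> A1 \<times> B1 = ?E \<inter> A \<times> B"
        unfolding A0_def A1_def B0_def B1_def by (auto simp: not_le) (meson not_le)
      then have "bi_spanner (?E \<inter> A \<times> B) (S0 \<union> S1)"
        using bi_spanner_Un[OF S0 S1(1)] by simp
      ultimately show ?thesis by blast
    qed
  qed
qed

lemma sparsely_spanned_point_interval:
  fixes lo hi :: "'a \<Rightarrow> nat" and x :: "'b \<Rightarrow> nat"
  shows "sparsely_spanned 2 {(a, b). lo a \<le> x b \<and> x b \<le> hi a}"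
  unfolding sparsely_spanned_def
proof (intro allI impI)
  fix A :: "'a set" and B :: "'b set" assume AB: "finite A" "finite B"
  obtain S where S: "bi_spanner ({(a, b). lo a \<le> x b \<and> x b \<le> hi a} \<inter> A \<times> B) S"
      "card S \<le> card B + card A + card {a \<in> A. \<exists>b\<in>B. x b < lo a}"
    using point_interval_bi_spanner[OF AB(2,1)] by blast
  have "card {a \<in> A. \<exists>b\<in>B. x b < lo a} \<le> card A" using AB by (intro card_mono) auto
  with S show "\<exists>S. bi_spanner ({(a, b). lo a \<le> x b \<and> x b \<le> hi a} \<inter> A \<times> B) S
      \<and> card S \<le> 2 * (card A + card B)"
    by (intro exI[of _ S]) auto
qed

section \<open>Several coordinates: induction on the dimension\<close>

definition starts_within :: "('a \<Rightarrow> 'i \<Rightarrow> nat) \<Rightarrow> ('a \<Rightarrow> 'i \<Rightarrow> nat) \<Rightarrow> 'i \<Rightarrow> ('a \<times> 'a) set" where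
  "starts_within lo hi i = {(a, b). lo a i \<le> lo b i \<and> lo b i \<le> hi a i}"

text \<open>In the coordinates of \<open>P\<close> the first box supplies the interval and the
  second the point; in all others the roles are exchanged.\<close>

definition oriented_meet ::
    "('a \<Rightarrow> 'i \<Rightarrow> nat) \<Rightarrow> ('a \<Rightarrow> 'i \<Rightarrow> nat) \<Rightarrow> 'i set \<Rightarrow> 'i set \<Rightarrow> ('a \<times> 'a) set" where
  "oriented_meet lo hi P I =
     {(a, b). \<forall>i\<in>I. (if i \<in> P then (a, b) else (b, a)) \<in> starts_within lo hi i}"

text \<open>The induction starts from one coordinate, handled by the greedy cover with constant 2;
  each further coordinate costs a factor \<open>2 * Suc L\<close>. This is where the exponent drops
  from \<open>card I\<close> to \<open>card I - 1\<close>.\<close>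

lemma sparsely_spanned_oriented_meet:
  assumes "finite I" "I \<noteq> {}" "\<And>a i. hi a i < 2 ^ L"
  shows "sparsely_spanned (2 * (2 * Suc L) ^ (card I - 1)) (oriented_meet lo hi P I)"
  using assms(1,2)
proof (induction I rule: finite_ne_induct)
  case (singleton i)
  have "sparsely_spanned 2 (starts_within lo hi i)"
    unfolding starts_within_def by (rule sparsely_spanned_point_interval)
  moreover from sparsely_spanned_converse[OF this] have "sparsely_spanned 2 ((starts_within lo hi i)\<inverse>)" .
  moreover have "oriented_meet lo hi P {i} =
      (if i \<in> P then starts_within lo hi i else (starts_within lo hi i)\<inverse>)"
    by (auto simp: oriented_meet_def)
  ultimately show ?case by simp
next
  case (insert i I)
  let ?K = "2 * (2 * Suc L) ^ (card I - 1)"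
  have step: "sparsely_spanned (2 * Suc L * ?K) (E \<inter> starts_within lo hi i)" if "sparsely_spanned ?K E" for E
  proof -
    have "E \<inter> starts_within lo hi i = {(a, b). (a, b) \<in> E \<and> lo a i \<le> lo b i \<and> lo b i \<le> hi a i}"
      by (auto simp: starts_within_def)
    then show ?thesis
      using sparsely_spanned_interval_constraint[OF that, of "\<lambda>a. hi a i" L "\<lambda>a. lo a i" "\<lambda>b. lo b i"] assms(3)
      by simp
  qed
  have "sparsely_spanned (2 * Suc L * ?K) (oriented_meet lo hi P (insert i I))"
  proof (cases "i \<in> P")
    case True
    then have "oriented_meet lo hi P (insert i I) = oriented_meet lo hi P I \<inter> starts_within lo hi i"
      by (auto simp: oriented_meet_def)
    then show ?thesis using step[OF insert.IH] by simp
  next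
    \<comment> \<open>With the roles exchanged in coordinate \<open>i\<close>, the relation is
      transposed, constrained, and transposed back.\<close>
    case False
    then have "oriented_meet lo hi P (insert i I) =
        ((oriented_meet lo hi P I)\<inverse> \<inter> starts_within lo hi i)\<inverse>"
      by (auto simp: oriented_meet_def)
    then show ?thesis
      using sparsely_spanned_converse[OF step[OF sparsely_spanned_converse[OF insert.IH]]] by simp
  qed
  moreover have "card I > 0" using insert.hyps by (simp add: card_gt_0_iff)
  then have "(2 * Suc L) ^ card I = 2 * Suc L * (2 * Suc L) ^ (card I - 1)"
    by (cases "card I") simp_all
  then have "2 * Suc L * ?K = 2 * (2 * Suc L) ^ (card (insert i I) - 1)"
    using insert.hyps by simp
  ultimately show ?case by simp
qed

section \<open>From boxes to integer intervals\<close>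

text \<open>Arbitrary intervals need not contain or even have endpoints, so they are compared only
  through a finite set of sample points, one for each pair of boxes. Endpoints become ranks among
  these points, which bounds them by the square of \<open>card F\<close>.\<close>

lemma box_family_ranks:
  fixes F :: "(real ^ 'd) set set"
  assumes "finite F" "\<forall>b\<in>F. axis_aligned_box b"
  shows "\<exists>lo hi :: (real ^ 'd) set \<Rightarrow> 'd \<Rightarrow> nat. (\<forall>a i. hi a i \<le> (card F)\<^sup>2) \<and>
    (\<forall>a\<in>F. \<forall>b\<in>F. a \<inter> b \<noteq> {} \<longleftrightarrow> (\<forall>i. lo a i \<le> hi b i \<and> lo b i \<le> hi a i))"
proof -
  obtain J :: "(real ^ 'd) set \<Rightarrow> 'd \<Rightarrow> real set"
    where J: "\<And>b i. b \<in> F \<Longrightarrow> is_interval (J b i)" "\<And>b. b \<in> F \<Longrightarrow> b = {x. \<forall>i. x $ i \<in> J b i}"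
    using assms(2) unfolding axis_aligned_box_def by metis
  \<comment> \<open>For a disjoint pair \<open>SOME\<close> yields an arbitrary point; extra sample
    points do no harm.\<close>
  define X where "X = (\<lambda>(a, b). SOME x. x \<in> a \<inter> b) ` (F \<times> F)"
  have finX: "finite X" using assms(1) by (simp add: X_def)
  have "card X \<le> card (F \<times> F)" unfolding X_def using assms(1) by (intro card_image_le) simp
  then have cardX: "card X \<le> (card F)\<^sup>2" by (simp add: card_cartesian_product power2_eq_square)
  have witness: "\<exists>x\<in>X. x \<in> a \<inter> b" if "a \<in> F" "b \<in> F" "a \<inter> b \<noteq> {}" for a b
  proof -
    have "(SOME x. x \<in> a \<inter> b) \<in> a \<inter> b" using that(3) unfolding some_in_eq .
    moreover have "(SOME x. x \<in> a \<inter> b) \<in> X" using that(1,2) by (force simp: X_def)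
    ultimately show ?thesis by blast
  qed
  \<comment> \<open>\<open>lo\<close> counts the points strictly before the interval and
    \<open>hi\<close> those not beyond it. Owing to the \<open>Suc\<close>,
    \<open>lo a i \<le> hi b i\<close> says that strictly more points are not beyond
    \<open>b\<close> than lie before \<open>a\<close>. An empty interval gets
    \<open>hi = 0 < lo\<close>.\<close>
  define lo where "lo a i = Suc (card {x \<in> X. \<forall>y\<in>J a i. x $ i < y})" for a i
  define hi where "hi a i = card {x \<in> X. \<exists>y\<in>J a i. x $ i \<le> y}" for a i
  have lo_le_hi: "lo a i \<le> hi b i" if "x \<in> X" "x $ i \<in> J a i" "x $ i \<in> J b i" for a b x i
  proof -
    have "w $ i \<le> x $ i" if "\<forall>y\<in>J a i. w $ i < y" for w
      using that \<open>x $ i \<in> J a i\<close> by (intro less_imp_le) (erule bspec)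
    then have "{x \<in> X. \<forall>y\<in>J a i. x $ i < y} \<subseteq> {x \<in> X. \<exists>y\<in>J b i. x $ i \<le> y}"
      using that(3) by blast
    moreover have "x \<in> {x \<in> X. \<exists>y\<in>J b i. x $ i \<le> y}" "x \<notin> {x \<in> X. \<forall>y\<in>J a i. x $ i < y}"
      using that by (blast intro: order_refl, auto)
    ultimately have "{x \<in> X. \<forall>y\<in>J a i. x $ i < y} \<subset> {x \<in> X. \<exists>y\<in>J b i. x $ i \<le> y}"
      by blast
    then show ?thesis using finX unfolding lo_def hi_def
      by (intro Suc_leI psubset_card_mono) auto
  qed
  have ordered: "\<exists>y\<in>J a i. \<exists>z\<in>J b i. y \<le> z" if "lo a i \<le> hi b i" for a b i
  proof -
    have "\<not> {x \<in> X. \<exists>y\<in>J b i. x $ i \<le> y} \<subseteq> {x \<in> X. \<forall>y\<in>J a i. x $ i < y}"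
      using that finX card_mono[of "{x \<in> X. \<forall>y\<in>J a i. x $ i < y}" "{x \<in> X. \<exists>y\<in>J b i. x $ i \<le> y}"]
      unfolding lo_def hi_def by auto
    then show ?thesis by (force simp: not_less)
  qed
  have "a \<inter> b \<noteq> {} \<longleftrightarrow> (\<forall>i. lo a i \<le> hi b i \<and> lo b i \<le> hi a i)" if ab: "a \<in> F" "b \<in> F" for a b
  proof
    assume "a \<inter> b \<noteq> {}"
    then obtain x where x: "x \<in> X" "x \<in> a" "x \<in> b" using witness[OF ab] by blast
    then have "x $ i \<in> J a i" "x $ i \<in> J b i" for i using J(2) ab by blast+
    then show "\<forall>i. lo a i \<le> hi b i \<and> lo b i \<le> hi a i" using lo_le_hi x(1) by blast
  next
    assume R: "\<forall>i. lo a i \<le> hi b i \<and> lo b i \<le> hi a i"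
    \<comment> \<open>Each interval has an element below or equal to some element of the other; the
      larger of the two lower elements \<open>y\<close> and \<open>y'\<close> lies in both.\<close>
    have "\<exists>t. t \<in> J a i \<and> t \<in> J b i" for i
    proof -
      obtain y z where yz: "y \<in> J a i" "z \<in> J b i" "y \<le> z" using ordered R by blast
      obtain y' z' where yz': "y' \<in> J b i" "z' \<in> J a i" "y' \<le> z'" using ordered R by blast
      have int: "is_interval (J a i)" "is_interval (J b i)" using J(1) ab by auto
      show ?thesis
        using mem_is_interval_1_I[OF int(1) yz(1) yz'(2), of y']
          mem_is_interval_1_I[OF int(2) yz'(1) yz(2), of y] yz yz'
        by (cases "y \<le> y'") auto
    qed
    then obtain t where t: "\<And>i. t i \<in> J a i \<and> t i \<in> J b i" by metis
    have "(\<chi> i. t i) \<in> a" by (subst J(2)[OF ab(1)]) (simp add: t)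
    moreover have "(\<chi> i. t i) \<in> b" by (subst J(2)[OF ab(2)]) (simp add: t)
    ultimately show "a \<inter> b \<noteq> {}" by blast
  qed
  moreover have "hi a i \<le> (card F)\<^sup>2" for a i
    unfolding hi_def using finX by (intro order_trans[OF card_mono cardX]) auto
  ultimately show ?thesis by blast
qed

section \<open>Paths, detours and hop distance\<close>

text \<open>Paths must not repeat vertices, so if \<open>z\<close> is already on the path, the path
  is cut off at \<open>z\<close> instead of prolonged. Allowing \<open>y = z\<close> admits idle
  steps.\<close>

lemma graph_path_extend:
  assumes p: "graph_path G x p y" and z: "z \<in> verts G" and "y = z \<or> {y, z} \<in> edges G"
  shows "\<exists>q. graph_path G x q z \<and> length q \<le> Suc (length p)"
proof (cases "z \<in> set p")
  case True
  then obtain i where i: "i < length p" "p ! i = z" by (auto simp: in_set_conv_nth)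
  have "graph_path G x (take (Suc i) p) z"
    unfolding graph_path_def
  proof (intro conjI allI impI)
    show "take (Suc i) p \<noteq> []" "distinct (take (Suc i) p)" "set (take (Suc i) p) \<subseteq> verts G"
      using p i by (auto simp: graph_path_def dest: in_set_takeD)
    show "hd (take (Suc i) p) = x" using p by (simp add: graph_path_def)
    show "last (take (Suc i) p) = z" using i by (simp add: take_Suc_conv_app_nth)
    show "{take (Suc i) p ! k, take (Suc i) p ! Suc k} \<in> edges G"
      if "Suc k < length (take (Suc i) p)" for k
      using p that by (simp add: graph_path_def)
  qed
  then show ?thesis by (intro exI[of _ "take (Suc i) p"]) auto
next
  case False
  then have "{y, z} \<in> edges G" using assms p by (auto simp: graph_path_def)
  have "graph_path G x (p @ [z]) z"
    unfolding graph_path_def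
  proof (intro conjI allI impI)
    fix i assume "Suc i < length (p @ [z])"
    then consider "Suc i < length p" | "Suc i = length p" by force
    then show "{(p @ [z]) ! i, (p @ [z]) ! Suc i} \<in> edges G"
    proof cases
      case 1
      then show ?thesis using p by (auto simp: graph_path_def nth_append)
    next
      case 2
      then have "(p @ [z]) ! i = y" using p
        by (auto simp: graph_path_def nth_append last_conv_nth simp flip: 2)
      moreover have "(p @ [z]) ! Suc i = z" using 2 by (simp add: nth_append)
      ultimately show ?thesis using \<open>{y, z} \<in> edges G\<close> by simp
    qed
  qed (use p z False in \<open>auto simp: graph_path_def\<close>)
  then show ?thesis by (intro exI[of _ "p @ [z]"]) auto
qed

text \<open>It suffices to bypass single edges: a shortest path of \<open>G\<close> is followed edge
  by edge, each replaced by at most three steps in \<open>H\<close>.\<close>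

lemma hop_spanner_3I:
  assumes simple: "simple_graph G" and V: "verts H = verts G" and E: "edges H \<subseteq> edges G"
    and detour: "\<And>x y. {x, y} \<in> edges G \<Longrightarrow> x \<noteq> y \<Longrightarrow> \<exists>u\<in>verts G. \<exists>v\<in>verts G.
      (x = u \<or> {x, u} \<in> edges H) \<and> (u = v \<or> {u, v} \<in> edges H) \<and> (v = y \<or> {v, y} \<in> edges H)"
  shows "hop_spanner 3 G H"
proof -
  have stretch: "\<exists>q. graph_path H x q y \<and> length q \<le> Suc (3 * (length p - 1))"
    if p: "graph_path G x p y" for x y p
  proof -
    have "\<exists>q. graph_path H x q (p ! i) \<and> length q \<le> Suc (3 * i)" if "i < length p" for i
      using that
    proof (induction i)
      case 0
      then have "graph_path H x [x] (p ! 0)"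
        using p V by (auto simp: graph_path_def hd_conv_nth)
      then show ?case by (intro exI[of _ "[x]"]) auto
    next
      case (Suc i)
      then obtain q where q: "graph_path H x q (p ! i)" "length q \<le> Suc (3 * i)" by auto
      have e: "{p ! i, p ! Suc i} \<in> edges G" "p ! i \<noteq> p ! Suc i" "p ! Suc i \<in> verts H"
        using p Suc.prems V by (auto simp: graph_path_def nth_eq_iff_index_eq)
      obtain u v where uv: "u \<in> verts H" "v \<in> verts H" "p ! i = u \<or> {p ! i, u} \<in> edges H"
          "u = v \<or> {u, v} \<in> edges H" "v = p ! Suc i \<or> {v, p ! Suc i} \<in> edges H"
        using detour[OF e(1,2)] V by auto
      obtain q1 where q1: "graph_path H x q1 u" "length q1 \<le> Suc (length q)"
        using graph_path_extend[OF q(1) uv(1,3)] by blast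
      obtain q2 where q2: "graph_path H x q2 v" "length q2 \<le> Suc (length q1)"
        using graph_path_extend[OF q1(1) uv(2,4)] by blast
      obtain q3 where "graph_path H x q3 (p ! Suc i)" "length q3 \<le> Suc (length q2)"
        using graph_path_extend[OF q2(1) e(3) uv(5)] by blast
      with q q1 q2 show ?case by (intro exI[of _ q3]) auto
    qed
    from this[of "length p - 1"] p show ?thesis
      by (auto simp: graph_path_def last_conv_nth)
  qed
  have "hop_dist H x y \<le> enat 3 * hop_dist G x y" for x y
  proof (cases "\<exists>p. graph_path G x p y")
    \<comment> \<open>Without a path in \<open>G\<close> the right-hand side is infinite.\<close>
    case False
    then show ?thesis by (simp add: hop_dist_def top_enat_def)
  next
    case True
    then obtain p0 where "graph_path G x p0 y" by blast
    \<comment> \<open>\<open>enat\<close> is well-ordered, so the infimum is attained by an actual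
      path.\<close>
    then have "hop_dist G x y \<in> (\<lambda>p. enat (length p - 1)) ` {p. graph_path G x p y}"
      unfolding hop_dist_def by (intro wellorder_InfI[of "enat (length p0 - 1)"]) auto
    then obtain p where p: "graph_path G x p y" "hop_dist G x y = enat (length p - 1)" by blast
    obtain q where q: "graph_path H x q y" "length q \<le> Suc (3 * (length p - 1))"
      using stretch[OF p(1)] by blast
    have "hop_dist H x y \<le> enat (length q - 1)"
      unfolding hop_dist_def using q(1) by (intro INF_lower) auto
    also have "\<dots> \<le> enat (3 * (length p - 1))" using q(2) by simp
    finally show ?thesis using p(2) by simp
  qed
  then show ?thesis using simple V E by (simp add: hop_spanner_def)
qed

section \<open>Spanners of box intersection graphs\<close>

lemma box_intersection_spanner:
  fixes F :: "(real ^ 'd::finite) set set"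
  assumes F: "finite F" "\<forall>b\<in>F. axis_aligned_box b" and L: "(card F)\<^sup>2 < 2 ^ L"
  shows "\<exists>H. hop_spanner 3 (intersection_graph F) H \<and>
    card (edges H) \<le> 2 ^ CARD('d) * (2 * (2 * Suc L) ^ (CARD('d) - 1)) * (2 * card F)"
proof -
  obtain lo hi :: "(real ^ 'd) set \<Rightarrow> 'd \<Rightarrow> nat" where
      ranks: "(\<forall>a i. hi a i \<le> (card F)\<^sup>2) \<and> (\<forall>a\<in>F. \<forall>b\<in>F.
        a \<inter> b \<noteq> {} \<longleftrightarrow> (\<forall>i. lo a i \<le> hi b i \<and> lo b i \<le> hi a i))"
    using box_family_ranks[OF F] by (elim exE)
  from ranks have hi: "hi a i \<le> (card F)\<^sup>2" for a i by simp
  from ranks have meet: "a \<inter> b \<noteq> {} \<longleftrightarrow> (\<forall>i. lo a i \<le> hi b i \<and> lo b i \<le> hi a i)"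
    if "a \<in> F" "b \<in> F" for a b
    using that by simp
  \<comment> \<open>The empty box is isolated in the intersection graph, and in some coordinate it
    violates \<open>lo \<le> hi\<close>, which is needed to pass from contained left endpoints to
    overlap.\<close>
  define N where "N = F - {{}}"
  let ?K = "2 * (2 * Suc L) ^ (CARD('d) - 1)"
  define E where "E = (\<Union>P\<in>UNIV. oriented_meet lo hi P UNIV)"
  have "sparsely_spanned (card (UNIV :: 'd set set) * ?K) E"
    unfolding E_def
    by (intro sparsely_spanned_UN sparsely_spanned_oriented_meet)
       (use hi L in \<open>auto intro: le_less_trans\<close>)
  moreover have "card (UNIV :: 'd set set) = 2 ^ CARD('d)"
    using card_Pow[of "UNIV :: 'd set"] by simp
  moreover have "finite N" using F by (simp add: N_def)
  ultimately obtain S where S: "bi_spanner (E \<inter> N \<times> N) S"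
      "card S \<le> 2 ^ CARD('d) * ?K * (card N + card N)"
    unfolding sparsely_spanned_def by metis
  have E: "(a, b) \<in> E \<longleftrightarrow> a \<inter> b \<noteq> {}" if ab: "a \<in> N" "b \<in> N" for a b
  proof -
    have ne: "lo a i \<le> hi a i" "lo b i \<le> hi b i" for i
      using meet[of a a] meet[of b b] ab by (auto simp: N_def)
    have "(a, b) \<in> E \<longleftrightarrow> (\<forall>i. lo a i \<le> hi b i \<and> lo b i \<le> hi a i)"
    proof
      assume "(a, b) \<in> E"
      then obtain P where P: "\<And>i. (if i \<in> P then (a, b) else (b, a)) \<in> starts_within lo hi i"
        by (auto simp: E_def oriented_meet_def)
      show "\<forall>i. lo a i \<le> hi b i \<and> lo b i \<le> hi a i"
      proof
        fix i
        show "lo a i \<le> hi b i \<and> lo b i \<le> hi a i"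
          using P[of i] ne[of i] by (auto simp: starts_within_def split: if_splits)
      qed
    next
      assume R: "\<forall>i. lo a i \<le> hi b i \<and> lo b i \<le> hi a i"
      \<comment> \<open>The orientation is chosen by which of the two boxes starts first in each
        coordinate.\<close>
      have "(a, b) \<in> oriented_meet lo hi {i. lo a i \<le> lo b i} UNIV"
        using R by (auto simp: oriented_meet_def starts_within_def)
      then show "(a, b) \<in> E" by (auto simp: E_def)
    qed
    then show ?thesis using meet ab by (simp add: N_def)
  qed
  \<comment> \<open>Both sides of the bipartite relation are \<open>N\<close>, so \<open>S\<close>
    may contain pairs \<open>(a, a)\<close>. They are discarded here and turn into idle steps of a
    detour.\<close>
  define H where "H = (F, {{a, b} | a b. (a, b) \<in> S \<and> a \<noteq> b})"
  have S_sub: "a \<in> F \<and> b \<in> F \<and> a \<inter> b \<noteq> {}" if "(a, b) \<in> S" for a b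
  proof -
    have "(a, b) \<in> E" "a \<in> N" "b \<in> N" using that S(1) by (auto simp: bi_spanner_def)
    then show ?thesis using E[of a b] by (simp add: N_def)
  qed
  have "hop_spanner 3 (intersection_graph F) H"
  proof (rule hop_spanner_3I)
    show "simple_graph (intersection_graph F)" by (rule simple_graph_intersection_graph)
    show "verts H = verts (intersection_graph F)" by (simp add: H_def intersection_graph_def)
    show "edges H \<subseteq> edges (intersection_graph F)"
    proof
      fix e assume "e \<in> edges H"
      then obtain a b where "e = {a, b}" "(a, b) \<in> S" "a \<noteq> b" by (auto simp: H_def)
      with S_sub[of a b] show "e \<in> edges (intersection_graph F)"
        by (auto simp: intersection_graph_def)
    qed
    fix x y assume "{x, y} \<in> edges (intersection_graph F)" "x \<noteq> y"
    then have xy: "x \<in> F" "y \<in> F" "x \<inter> y \<noteq> {}"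
      by (auto simp: intersection_graph_def doubleton_eq_iff)
    then have "x \<in> N" "y \<in> N" by (auto simp: N_def)
    then have "(x, y) \<in> E \<inter> N \<times> N" using E[of x y] xy(3) by simp
    then obtain v u where uv: "(x, u) \<in> S" "(v, u) \<in> S" "(v, y) \<in> S"
      using S(1) unfolding bi_spanner_def by blast
    have near: "a = b \<or> {a, b} \<in> edges H" if "(a, b) \<in> S" for a b
      using that by (auto simp: H_def)
    show "\<exists>u\<in>verts (intersection_graph F). \<exists>v\<in>verts (intersection_graph F).
        (x = u \<or> {x, u} \<in> edges H) \<and> (u = v \<or> {u, v} \<in> edges H) \<and> (v = y \<or> {v, y} \<in> edges H)"
      using near[OF uv(1)] near[OF uv(2)] near[OF uv(3)] S_sub[OF uv(1)] S_sub[OF uv(2)]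
      by (intro bexI[of _ u] bexI[of _ v]) (auto simp: intersection_graph_def insert_commute)
  qed
  moreover have "card (edges H) \<le> 2 ^ CARD('d) * ?K * (2 * card F)"
  proof -
    have "finite S" using S(1) \<open>finite N\<close> unfolding bi_spanner_def
      by (meson finite_Int finite_SigmaI finite_subset)
    have "edges H \<subseteq> (\<lambda>(a, b). {a, b}) ` S" by (auto simp: H_def)
    then have "card (edges H) \<le> card ((\<lambda>(a, b). {a, b}) ` S)"
      using \<open>finite S\<close> by (intro card_mono) auto
    also have "\<dots> \<le> card S" using \<open>finite S\<close> by (rule card_image_le)
    also have "\<dots> \<le> 2 ^ CARD('d) * ?K * (card N + card N)" by (rule S(2))
    also have "\<dots> \<le> 2 ^ CARD('d) * ?K * (2 * card F)"
      using F(1) card_mono[of F N] by (intro mult_left_mono) (auto simp: N_def)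
    finally show ?thesis .
  qed
  ultimately show ?thesis by blast
qed

theorem theorem4p1:
  shows "\<exists>f :: nat \<Rightarrow> real. f \<in> O(\<lambda>n. real n * ln (real n) ^ (CARD('d::finite) - 1)) \<and>
    (\<forall>n. \<forall>\<B> :: (real ^ 'd) set set.
       finite \<B> \<and> card \<B> = n \<and> (\<forall>b \<in> \<B>. axis_aligned_box b) \<longrightarrow>
       (\<exists>H. hop_spanner 3 (intersection_graph \<B>) H \<and> real (card (edges H)) \<le> f n))"
proof -
  \<comment> \<open>Ranks go up to the square of \<open>n\<close>, hence twice the logarithm; the
    outer \<open>Suc\<close> makes the inequality below strict.\<close>
  define L where "L n = Suc (nat \<lceil>2 * log 2 (real n)\<rceil>)" for n :: nat
  have L: "n\<^sup>2 < 2 ^ L n" for n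
  proof (cases "n = 0")
    case False
    have "(real n)\<^sup>2 = 2 powr (2 * log 2 (real n))"
      using False by (simp add: powr_powr[symmetric] mult.commute[of 2])
    also have "\<dots> < 2 powr real (L n)"
      unfolding L_def by (intro powr_less_mono) linarith+
    also have "\<dots> = real (2 ^ L n)" by (simp add: powr_realpow)
    finally show ?thesis by (metis of_nat_less_iff of_nat_power)
  qed simp
  define f where "f n = real (2 ^ CARD('d) * (2 * (2 * Suc (L n)) ^ (CARD('d) - 1)) * (2 * n))" for n
  have "(\<lambda>n. real (2 * Suc (L n))) \<in> O(\<lambda>n. ln (real n))"
  proof (rule bigoI)
    show "\<forall>\<^sub>F n in at_top. norm (real (2 * Suc (L n))) \<le> (4 / ln 2 + 6) * norm (ln (real n))"
      \<comment> \<open>From 3 on, \<open>ln (real n)\<close> is at least 1 and absorbs the additive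
        constant 6.\<close>
      using eventually_ge_at_top[of 3]
    proof eventually_elim
      case (elim n)
      have "exp 1 \<le> real n" using exp_le elim by linarith
      then have ln1: "1 \<le> ln (real n)" using elim by (simp add: ln_ge_iff)
      have "real (2 * Suc (L n)) \<le> 2 * (2 * log 2 (real n) + 3)"
        using elim unfolding L_def by simp linarith
      also have "\<dots> = (4 / ln 2) * ln (real n) + 6" by (simp add: log_def)
      also have "\<dots> \<le> (4 / ln 2 + 6) * ln (real n)" using ln1 by (simp add: algebra_simps)
      finally show ?case using ln1 by simp
    qed
  qed
  then have "(\<lambda>n. real (2 * Suc (L n)) ^ (CARD('d) - 1)) \<in> O(\<lambda>n. ln (real n) ^ (CARD('d) - 1))"
    by (rule landau_o.big_power)
  then have "(\<lambda>n. (4 * 2 ^ CARD('d)) * (real n * real (2 * Suc (L n)) ^ (CARD('d) - 1)))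
      \<in> O(\<lambda>n. real n * ln (real n) ^ (CARD('d) - 1))"
    by (intro landau_o.big.cmult_in_iff[THEN iffD2] landau_o.big_mult) simp_all
  also have "(\<lambda>n. (4 * 2 ^ CARD('d)) * (real n * real (2 * Suc (L n)) ^ (CARD('d) - 1))) = f"
    by (auto simp: f_def fun_eq_iff)
  finally have "f \<in> O(\<lambda>n. real n * ln (real n) ^ (CARD('d) - 1))" .
  moreover have "\<exists>H. hop_spanner 3 (intersection_graph \<B>) H \<and> real (card (edges H)) \<le> f n"
    if "finite \<B> \<and> card \<B> = n \<and> (\<forall>b \<in> \<B>. axis_aligned_box b)" for n and \<B> :: "(real ^ 'd) set set"
    using box_intersection_spanner[of \<B> "L n"] that L[of n] unfolding f_def of_nat_le_iff by blast
  ultimately show ?thesis by blast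
qed

end
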